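(* Let $X$ be a real Hilbert space. Equip the quotient set $[\Gamma_0(X)]=\Gamma_0(X)/{\sim}$ with the binary relation $$[g]\preceq[f]\;:\Leftrightarrow\;[P_f]\preceq[P_g]\;\Leftrightarrow\;P_f\preceq P_g.$$ Then $\big([\Gamma_0(X)],\preceq\big)$ is a partially ordered set.
   Context: $X$ is a real Hilbert space with inner product $\langle\cdot,\cdot\rangle$ and induced norm $\|\cdot\|$. $\Gamma_0(X)$ is the set of all convex, lower semicontinuous, proper functions $X\to\mathbb{R}\cup\{+\infty\}$. The equivalence relation on $\Gamma_0(X)$ is: $f\sim g$ if and only if there exist $c\in X$ and $\gamma\in\mathbb{R}$ such that $g(x)=f(x-c)-\langle c,x\rangle+\gamma$ for all $x\in X$. The proximal mapping of $f$ is $P_f=(\operatorname{Id}+\partial f)^{-1}\colon X\to X$, where $\partial f$ is the subdifferential. $\mathcal{F}(X)$ is the set of firmly nonexpansive mappings, i.e. $T\colon X\to X$ with $\|Tx-Ty\|^2\le\langle x-y,Tx-Ty\rangle$ for all $x,y\in X$; every proximal mapping is in $\mathcal{F}(X)$. On $\mathcal{F}(X)$, $T_1\preceq T_2 :\Leftrightarrow T_2-T_1\in\mathcal{F}(X)$, and $T_1\sim T_2:\Leftrightarrow T_2-T_1$ is a constant mapping; $[T]$ denotes the class of $T$ under $\sim$, and $[T_1]\preceq[T_2]:\Leftrightarrow T_1\preceq T_2$. A partially ordered set is a set with a reflexive, antisymmetric, transitive relation. *)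

theory Defs
  imports "HOL-Analysis.Analysis"
begin

text \<open>
  A real Hilbert space is a type of sort \<open>{real_inner, complete_space}\<close>. Functions into
  \<open>\<real> \<union> {+\<infinity>}\<close> are \<open>ereal\<close>-valued functions that never take the value \<open>-\<infinity>\<close>; this is part of
  \<open>proper\<close>.
\<close>

definition proper :: "('a \<Rightarrow> ereal) \<Rightarrow> bool" where
  "proper f \<longleftrightarrow> (\<forall>x. f x \<noteq> -\<infinity>) \<and> (\<exists>x. f x \<noteq> \<infinity>)"

text \<open>The weights are strictly between 0 and 1, so the convention \<open>0 * \<infinity> = 0\<close> plays no role.\<close>

definition convex_ereal :: "('a::real_vector \<Rightarrow> ereal) \<Rightarrow> bool" where
  "convex_ereal f \<longleftrightarrow>
    (\<forall>x y. \<forall>t::real. 0 < t \<and> t < 1 \<longrightarrow>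
      f ((1 - t) *\<^sub>R x + t *\<^sub>R y) \<le> ereal (1 - t) * f x + ereal t * f y)"

definition lsc :: "('a::topological_space \<Rightarrow> ereal) \<Rightarrow> bool" where
  "lsc f \<longleftrightarrow> (\<forall>x. f x \<le> Liminf (at x) f)"

definition Gamma0 :: "('a::real_inner \<Rightarrow> ereal) set" where
  "Gamma0 = {f. convex_ereal f \<and> lsc f \<and> proper f}"

definition Gamma0_sim :: "(('a::real_inner \<Rightarrow> ereal) \<times> ('a \<Rightarrow> ereal)) set" where
  "Gamma0_sim = {(f, g). f \<in> Gamma0 \<and> g \<in> Gamma0 \<and>
     (\<exists>c. \<exists>\<gamma>::real. \<forall>x. g x = f (x - c) - ereal (c \<bullet> x) + ereal \<gamma>)}"

text \<open>For proper \<open>f\<close> this set is empty wherever \<open>f x = \<infinity>\<close>.\<close>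

definition subdiff :: "('a::real_inner \<Rightarrow> ereal) \<Rightarrow> 'a \<Rightarrow> 'a set" where
  "subdiff f x = {u. \<forall>y. f x + ereal (u \<bullet> (y - x)) \<le> f y}"

text \<open>
  The graph of \<open>(Id + \<partial>f)\<inverse>\<close>. For \<open>f \<in> Gamma0\<close> on a Hilbert space it is the graph of a function
  defined everywhere (Minty), which \<open>prox f\<close> denotes.
\<close>

definition prox_rel :: "('a::real_inner \<Rightarrow> ereal) \<Rightarrow> ('a \<times> 'a) set" where
  "prox_rel f = {(p, p + u) | p u. u \<in> subdiff f p}\<inverse>"

definition prox :: "('a::real_inner \<Rightarrow> ereal) \<Rightarrow> 'a \<Rightarrow> 'a" where
  "prox f x = (THE p. (x, p) \<in> prox_rel f)"

definition Firm :: "('a::real_inner \<Rightarrow> 'a) set" where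
  "Firm = {T. \<forall>x y. (norm (T x - T y))\<^sup>2 \<le> (x - y) \<bullet> (T x - T y)}"

definition firm_le :: "('a::real_inner \<Rightarrow> 'a) \<Rightarrow> ('a \<Rightarrow> 'a) \<Rightarrow> bool" where
  "firm_le T1 T2 \<longleftrightarrow> (\<lambda>x. T2 x - T1 x) \<in> Firm"

definition Firm_sim :: "(('a::real_inner \<Rightarrow> 'a) \<times> ('a \<Rightarrow> 'a)) set" where
  "Firm_sim = {(T1, T2). T1 \<in> Firm \<and> T2 \<in> Firm \<and> (\<exists>c. \<forall>x. T2 x - T1 x = c)}"

definition Firm_class_le :: "(('a::real_inner \<Rightarrow> 'a) set \<times> ('a \<Rightarrow> 'a) set) set" where
  "Firm_class_le = {(Firm_sim `` {T1}, Firm_sim `` {T2}) | T1 T2.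
     T1 \<in> Firm \<and> T2 \<in> Firm \<and> firm_le T1 T2}"

text \<open>The order is reversed: the class of \<open>g\<close> lies below that of \<open>f\<close> if \<open>[P\<^sub>f]\<close> lies below \<open>[P\<^sub>g]\<close>.\<close>

definition Gamma0_class_le :: "(('a::real_inner \<Rightarrow> ereal) set \<times> ('a \<Rightarrow> ereal) set) set" where
  "Gamma0_class_le = {(Gamma0_sim `` {g}, Gamma0_sim `` {f}) | g f.
     g \<in> Gamma0 \<and> f \<in> Gamma0 \<and>
     (Firm_sim `` {prox f}, Firm_sim `` {prox g}) \<in> Firm_class_le}"

lemma equiv_Gamma0_sim: "equiv (Gamma0 :: ('a::real_inner \<Rightarrow> ereal) set) Gamma0_sim"
proof (rule equivI)
  show "Gamma0_sim \<subseteq> (Gamma0 :: ('a \<Rightarrow> ereal) set) \<times> Gamma0"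
    by (auto simp: Gamma0_sim_def)
  show "refl_on (Gamma0 :: ('a \<Rightarrow> ereal) set) Gamma0_sim"
    unfolding refl_on_def Gamma0_sim_def
    by (auto intro!: exI[of _ 0] simp: zero_ereal_def[symmetric])
  show "sym (Gamma0_sim :: (('a \<Rightarrow> ereal) \<times> _) set)"
  proof (rule symI)
    fix f g :: "'a \<Rightarrow> ereal"
    assume "(f, g) \<in> Gamma0_sim"
    then obtain c \<gamma> where fg: "f \<in> Gamma0" "g \<in> Gamma0"
      and g: "\<And>x. g x = f (x - c) - ereal (c \<bullet> x) + ereal \<gamma>"
      by (auto simp: Gamma0_sim_def)
    have "f x = g (x - (- c)) - ereal (- c \<bullet> x) + ereal (c \<bullet> c - \<gamma>)" for x
      by (cases "f x") (simp_all add: g inner_add_right)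
    with fg show "(g, f) \<in> Gamma0_sim"
      unfolding Gamma0_sim_def by blast
  qed
  show "trans (Gamma0_sim :: (('a \<Rightarrow> ereal) \<times> _) set)"
  proof (rule transI)
    fix f g h :: "'a \<Rightarrow> ereal"
    assume "(f, g) \<in> Gamma0_sim" "(g, h) \<in> Gamma0_sim"
    then obtain c \<gamma> d \<delta> where fh: "f \<in> Gamma0" "h \<in> Gamma0"
      and g: "\<And>x. g x = f (x - c) - ereal (c \<bullet> x) + ereal \<gamma>"
      and h: "\<And>x. h x = g (x - d) - ereal (d \<bullet> x) + ereal \<delta>"
      by (auto simp: Gamma0_sim_def)
    have "h x = f (x - (c + d)) - ereal ((c + d) \<bullet> x) + ereal (c \<bullet> d + \<gamma> + \<delta>)" for x
    proof -
      have eq: "x - (c + d) = x - d - c" by simp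
      show ?thesis unfolding eq
        by (cases "f (x - d - c)")
           (simp_all add: g h inner_add_left inner_diff_right)
    qed
    with fh show "(f, h) \<in> Gamma0_sim"
      unfolding Gamma0_sim_def by blast
  qed
qed

lemma equiv_Firm_sim: "equiv (Firm :: ('a::real_inner \<Rightarrow> 'a) set) Firm_sim"
proof (rule equivI)
  show "Firm_sim \<subseteq> (Firm :: ('a \<Rightarrow> 'a) set) \<times> Firm" "refl_on (Firm :: ('a \<Rightarrow> 'a) set) Firm_sim"
    by (auto simp: Firm_sim_def refl_on_def)
  show "sym (Firm_sim :: (('a \<Rightarrow> 'a) \<times> _) set)"
    unfolding sym_def Firm_sim_def by clarsimp (metis minus_diff_eq)
  show "trans (Firm_sim :: (('a \<Rightarrow> 'a) \<times> _) set)"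
    unfolding trans_def Firm_sim_def by clarsimp (metis diff_add_cancel diff_diff_eq2)
qed

end

theory Submission
  imports Defs
begin

text \<open>
  Write \<open>P\<^sub>f\<close> for \<open>prox f\<close> and \<open>q x = \<parallel>x\<parallel>\<^sup>2 / 2\<close>. Everything rests on one fact: \<open>P\<^sub>f\<close> is the gradient
  of a finite convex function \<open>h\<^sub>f\<close>, the Fenchel conjugate of \<open>f + q\<close>, and \<open>f + q\<close> is recovered from
  \<open>h\<^sub>f\<close> by a second conjugation.

  Transitivity is the point at which proximal mappings differ from general firmly nonexpansive
  ones: a sum of two firmly nonexpansive mappings need not be firmly nonexpansive. If
  \<open>P\<^sub>g - P\<^sub>f\<close> and \<open>P\<^sub>k - P\<^sub>g\<close> are firmly nonexpansive, then \<open>S = P\<^sub>k - P\<^sub>f\<close> is monotone as a sum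
  of monotone mappings. So is \<open>Id - S = (Id - P\<^sub>k) + P\<^sub>f\<close>. As \<open>S\<close> is the gradient of
  \<open>h\<^sub>k - h\<^sub>f\<close>, the Baillon-Haddad theorem (\<open>Baillon_Haddad\<close>) turns these two monotonicities into
  firm nonexpansiveness (\<open>firm_le_prox_trans\<close>).

  Antisymmetry: if both \<open>P\<^sub>g - P\<^sub>f\<close> and its negative are monotone and one of them is firmly
  nonexpansive, the difference is a constant \<open>c\<close>. Then \<open>h\<^sub>g - h\<^sub>f\<close> is affine with slope \<open>c\<close>, and
  conjugating back gives \<open>g = f(\<cdot> - c) - \<langle>c, \<cdot>\<rangle> + \<gamma>\<close>, i.e. \<open>f \<sim> g\<close>. Conversely \<open>f \<sim> g\<close> shifts the
  proximal mapping by a constant, so that the map \<open>[f] \<mapsto> [P\<^sub>f]\<close> is well defined and injective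
  (\<open>Gamma0_sim_iff_prox\<close>) and the order can be read off on representatives.

  The analysis behind this needs no separation theorem. A function in \<open>Gamma0\<close> has a cone
  \<open>a - b \<parallel>\<cdot> - x\<parallel>\<close> below it, so \<open>f + K \<parallel>\<cdot> - x\<parallel>\<^sup>2\<close> is bounded below, and by strong convexity and
  completeness it attains its minimum (\<open>Gamma0_regularized_minimizer\<close>). The case \<open>K = 1/2\<close> yields
  \<open>P\<^sub>f\<close>; large \<open>K\<close> yields affine minorants of \<open>f + q\<close> whose values at a given point exceed any number
  below that of \<open>f + q\<close>, which is the recovery of \<open>f\<close> from \<open>h\<^sub>f\<close> (\<open>Gamma0_eq_SUP_prox_potential\<close>).
\<close>

section \<open>Regularized minimization\<close>

lemma lsc_less_nhds:
  fixes f :: "'a::metric_space \<Rightarrow> ereal"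
  assumes "lsc f" and "r < f x"
  obtains d where "d > 0" and "\<And>y. dist y x < d \<Longrightarrow> r < f y"
proof -
  have "r < Liminf (at x) f"
    using assms unfolding lsc_def by (meson less_le_trans)
  then have "eventually (\<lambda>y. r < f y) (at x)"
    by (rule less_LiminfD)
  then obtain d where "d > 0" "\<And>y. y \<noteq> x \<Longrightarrow> dist y x < d \<Longrightarrow> r < f y"
    unfolding eventually_at by auto
  with assms(2) that show thesis by metis
qed

lemma Gamma0_convexD:
  fixes x y :: "'a::real_inner"
  assumes "f \<in> Gamma0" and "0 < t" and "t < 1" and "f x = ereal a" and "f y = ereal b"
  shows "f ((1 - t) *\<^sub>R x + t *\<^sub>R y) \<le> ereal ((1 - t) * a + t * b)"
proof -
  have "f ((1 - t) *\<^sub>R x + t *\<^sub>R y) \<le> ereal (1 - t) * f x + ereal t * f y"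
    using assms(1-3) unfolding Gamma0_def convex_ereal_def by blast
  then show ?thesis using assms(4,5) by simp
qed

lemma Gamma0_not_MInfty: "f \<in> Gamma0 \<Longrightarrow> f x \<noteq> -\<infinity>"
  unfolding Gamma0_def proper_def by blast

lemma Gamma0_finite_point:
  assumes "f \<in> Gamma0"
  obtains x a where "f x = ereal a"
proof -
  from assms obtain x where "f x \<noteq> \<infinity>" "f x \<noteq> -\<infinity>"
    unfolding Gamma0_def proper_def by blast
  with that show thesis by (cases "f x") auto
qed

text \<open>
  By lower semicontinuity \<open>f\<close> is bounded below by \<open>f w - 1\<close> on a ball around a point \<open>w\<close> of its
  domain. A point far from \<open>w\<close> is joined to \<open>w\<close> by a segment that passes through this ball, and
  convexity along the segment turns the bound inside the ball into a linear one outside.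
\<close>

lemma Gamma0_cone_minorant:
  fixes f :: "'a::real_inner \<Rightarrow> ereal"
  assumes f: "f \<in> Gamma0"
  obtains a b where "b \<ge> 0" and "\<forall>y. ereal (a - b * norm (y - x)) \<le> f y"
proof -
  obtain w c where w: "f w = ereal c"
    using Gamma0_finite_point[OF f] .
  have "lsc f" using f by (simp add: Gamma0_def)
  then obtain d where d: "d > 0" "\<And>y. dist y w < d \<Longrightarrow> ereal (c - 1) < f y"
    using lsc_less_nhds[of f "ereal (c - 1)" w] w by auto
  have *: "ereal (c - 1 - (2 / d) * norm (y - w)) \<le> f y" for y
  proof (cases "dist y w < d")
    case True
    have "ereal (c - 1 - (2 / d) * norm (y - w)) \<le> ereal (c - 1)"
      using d(1) by simp
    also have "\<dots> \<le> f y" using d(2)[OF True] by simp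
    finally show ?thesis .
  next
    case False
    define s where "s = norm (y - w)"
    have s: "s \<ge> d" using False by (simp add: s_def dist_norm)
    show ?thesis
    proof (cases "f y")
      case (real e)
      \<comment> \<open>The point at parameter \<open>t\<close> on the segment from \<open>w\<close> to \<open>y\<close> has distance \<open>d / 2\<close> from \<open>w\<close>.\<close>
      define t where "t = d / (2 * s)"
      have t: "0 < t" "t < 1" using d(1) s by (auto simp: t_def field_simps)
      have ts: "t * s = d / 2" using d(1) s by (simp add: t_def)
      have "(1 - t) *\<^sub>R w + t *\<^sub>R y - w = t *\<^sub>R (y - w)"
        by (simp add: algebra_simps)
      then have "dist ((1 - t) *\<^sub>R w + t *\<^sub>R y) w = t * s"
        using t by (simp add: dist_norm s_def)
      then have "ereal (c - 1) < f ((1 - t) *\<^sub>R w + t *\<^sub>R y)"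
        using d ts by simp
      also have "\<dots> \<le> ereal ((1 - t) * c + t * e)"
        using Gamma0_convexD[OF f t w real] .
      finally have "- 1 < t * (e - c)" by (simp add: algebra_simps)
      then have "- 1 / t < e - c" using t by (simp add: field_simps)
      moreover have "1 / t = (2 / d) * s" using d(1) s by (simp add: t_def)
      ultimately show ?thesis using real by (simp add: s_def)
    qed (use Gamma0_not_MInfty[OF f] in auto)
  qed
  have "ereal (c - 1 - (2 / d) * norm (x - w) - (2 / d) * norm (y - x)) \<le> f y" for y
  proof -
    have "norm (y - w) \<le> norm (x - w) + norm (y - x)"
      using norm_triangle_ineq[of "x - w" "y - x"] by simp
    then have "(2 / d) * norm (y - w) \<le> (2 / d) * norm (x - w) + (2 / d) * norm (y - x)"
      using d(1) by (simp add: field_simps)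
    then have "ereal (c - 1 - (2 / d) * norm (x - w) - (2 / d) * norm (y - x))
        \<le> ereal (c - 1 - (2 / d) * norm (y - w))" by simp
    with *[of y] show ?thesis by (rule order_trans[rotated])
  qed
  with that[of "2 / d" "c - 1 - (2 / d) * norm (x - w)"] d(1) show thesis by simp
qed

lemma norm_midpoint_power2:
  fixes u v :: "'a::real_inner"
  shows "(norm ((1/2) *\<^sub>R u + (1/2) *\<^sub>R v))\<^sup>2 = ((norm u)\<^sup>2 + (norm v)\<^sup>2) / 2 - (norm (u - v))\<^sup>2 / 4"
  by (simp add: power2_norm_eq_inner inner_add_left inner_add_right inner_diff_left
      inner_diff_right inner_commute field_simps)

text \<open>
  The quadratic term dominates the cone minorant, so the infimum \<open>m\<close> is finite. The parallelogram
  law, applied to the midpoint of two almost minimizing points, shows that they are close to each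
  other; hence a minimizing sequence is Cauchy, and lower semicontinuity passes \<open>m\<close> to its limit.
\<close>

lemma Gamma0_regularized_minimizer:
  fixes f :: "'a::{real_inner, complete_space} \<Rightarrow> ereal"
  assumes f: "f \<in> Gamma0" and K: "K > 0"
  obtains p a where "f p = ereal a"
    and "\<And>y b. f y = ereal b \<Longrightarrow> a + K * (norm (p - x))\<^sup>2 \<le> b + K * (norm (y - x))\<^sup>2"
proof -
  define A where "A = {b + K * (norm (y - x))\<^sup>2 | y b. f y = ereal b}"
  obtain a b where b: "b \<ge> 0" and minor: "\<forall>y. ereal (a - b * norm (y - x)) \<le> f y"
    using Gamma0_cone_minorant[OF f, where x = x] .
  have "a - b\<^sup>2 / (4 * K) \<le> v" if v: "v \<in> A" for v
  proof -
    obtain y c where y: "f y = ereal c" "v = c + K * (norm (y - x))\<^sup>2"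
      using v unfolding A_def by blast
    have c: "a - b * norm (y - x) \<le> c" using minor y by (metis ereal_less_eq(3))
    have "0 \<le> K * (norm (y - x) - b / (2 * K))\<^sup>2" using K by simp
    also have "\<dots> = K * (norm (y - x))\<^sup>2 - b * norm (y - x) + b\<^sup>2 / (4 * K)"
      using K by (simp add: power2_eq_square field_simps)
    finally show ?thesis using c y by simp
  qed
  then have bdd: "bdd_below A" by (rule bdd_belowI)
  obtain w c where "f w = ereal c" using Gamma0_finite_point[OF f] .
  then have "c + K * (norm (w - x))\<^sup>2 \<in> A" unfolding A_def by blast
  then have ne: "A \<noteq> {}" by blast
  define m where "m = Inf A"
  have m: "m \<le> c + K * (norm (y - x))\<^sup>2" if "f y = ereal c" for y c
    unfolding m_def by (rule cInf_lower[OF _ bdd]) (use that in \<open>auto simp: A_def\<close>)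
  have "\<exists>y c. f y = ereal c \<and> c + K * (norm (y - x))\<^sup>2 < m + 1 / Suc n" for n
  proof -
    have "Inf A < m + 1 / Suc n" by (simp add: m_def)
    then obtain v where "v \<in> A" "v < m + 1 / Suc n" using cInf_less_iff[OF ne bdd] by blast
    then show ?thesis unfolding A_def by blast
  qed
  then obtain y c where yc: "\<And>n. f (y n) = ereal (c n)"
    "\<And>n. c n + K * (norm (y n - x))\<^sup>2 < m + 1 / Suc n"
    by metis
  have gap: "K / 4 * (norm (y i - y j))\<^sup>2 < 1 / Suc N" if "N \<le> i" "N \<le> j" for i j N
  proof -
    define z where "z = (1 - 1/2) *\<^sub>R y i + (1/2) *\<^sub>R y j"
    have z: "f z \<le> ereal ((1 - 1/2) * c i + 1/2 * c j)"
      unfolding z_def by (rule Gamma0_convexD[OF f]) (use yc in auto)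
    then obtain e where e: "f z = ereal e"
      using Gamma0_not_MInfty[OF f, of z] by (cases "f z") auto
    have "z - x = (1/2) *\<^sub>R (y i - x) + (1/2) *\<^sub>R (y j - x)"
      by (simp add: z_def algebra_simps flip: scaleR_left_distrib)
    then have "(norm (z - x))\<^sup>2
        = ((norm (y i - x))\<^sup>2 + (norm (y j - x))\<^sup>2) / 2 - (norm (y i - y j))\<^sup>2 / 4"
      by (simp add: norm_midpoint_power2)
    then have "K * (norm (z - x))\<^sup>2
        = (K * (norm (y i - x))\<^sup>2 + K * (norm (y j - x))\<^sup>2) / 2 - K / 4 * (norm (y i - y j))\<^sup>2"
      by (simp only:) (simp add: distrib_left right_diff_distrib add_divide_distrib)
    moreover have "m \<le> e + K * (norm (z - x))\<^sup>2" using m[OF e] .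
    moreover have "e \<le> c i / 2 + c j / 2" using z e by simp
    moreover have "1 / real (Suc i) \<le> 1 / Suc N" "1 / real (Suc j) \<le> 1 / Suc N"
      using that by (auto intro!: divide_left_mono)
    moreover have "G < s" if "Q = (a + b) / 2 - G" "m \<le> e + Q" "e \<le> u / 2 + v / 2" "r \<le> s"
      "t \<le> s" "u + a < m + r" "v + b < m + t" for Q a b G u v r s t :: real
      using that by argo
    ultimately show ?thesis using yc(2)[of i] yc(2)[of j] by blast
  qed
  have "Cauchy y"
  proof (rule metric_CauchyI)
    fix e :: real assume "e > 0"
    then have "K / 4 * e\<^sup>2 > 0" using K by simp
    then obtain N where N: "1 / real (Suc N) < K / 4 * e\<^sup>2"
      using nat_approx_posE by blast
    have "dist (y i) (y j) < e" if "N \<le> i" "N \<le> j" for i j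
    proof -
      have "K / 4 * (norm (y i - y j))\<^sup>2 < K / 4 * e\<^sup>2"
        using gap[OF that] N by linarith
      then have "(norm (y i - y j))\<^sup>2 < e\<^sup>2" using K by simp
      then show ?thesis using \<open>e > 0\<close> by (simp add: dist_norm power2_less_imp_less)
    qed
    then show "\<exists>M. \<forall>m\<ge>M. \<forall>n\<ge>M. dist (y m) (y n) < e" by blast
  qed
  then obtain p where p: "y \<longlonglongrightarrow> p"
    using Cauchy_convergent convergent_def by blast
  have "f p \<le> ereal (m - K * (norm (p - x))\<^sup>2)"
  proof (rule ccontr)
    assume "\<not> ?thesis"
    then obtain r where r: "ereal (m - K * (norm (p - x))\<^sup>2) < ereal r" "ereal r < f p"
      using ereal_dense2[of "ereal (m - K * (norm (p - x))\<^sup>2)" "f p"] by (auto simp: not_le)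
    obtain d where d: "d > 0" "\<And>z. dist z p < d \<Longrightarrow> ereal r < f z"
      using lsc_less_nhds[of f "ereal r" p] r f unfolding Gamma0_def by blast
    have "eventually (\<lambda>n. dist (y n) p < d) sequentially"
      using p d(1) by (rule tendstoD)
    then have ev: "eventually (\<lambda>n. r + K * (norm (y n - x))\<^sup>2 \<le> m + 1 / Suc n) sequentially"
    proof eventually_elim
      case (elim n)
      then show ?case using d(2)[of "y n"] yc[of n] by simp
    qed
    have "r + K * (norm (p - x))\<^sup>2 \<le> m + 0"
    proof (rule tendsto_le[OF _ _ _ ev])
      show "(\<lambda>n. r + K * (norm (y n - x))\<^sup>2) \<longlonglongrightarrow> r + K * (norm (p - x))\<^sup>2"
        by (intro tendsto_intros p)
      show "(\<lambda>n. m + 1 / Suc n) \<longlonglongrightarrow> m + 0"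
        by (intro tendsto_intros lim_1_over_n[THEN LIMSEQ_Suc])
    qed simp
    with r(1) show False by simp
  qed
  then obtain e where e: "f p = ereal e" "e + K * (norm (p - x))\<^sup>2 \<le> m"
    using Gamma0_not_MInfty[OF f, of p] by (cases "f p") auto
  show thesis
    by (rule that[OF e(1)]) (use e(2) m in \<open>auto intro: order_trans\<close>)
qed

lemma subdiff_ereal:
  "u \<in> subdiff f p \<Longrightarrow> f p = ereal a \<Longrightarrow> f y = ereal b \<Longrightarrow> a + u \<bullet> (y - p) \<le> b"
  unfolding subdiff_def by (auto dest!: spec[of _ y])

text \<open>
  The optimality condition \<open>0 \<in> \<partial>f(p) + 2 K (p - x)\<close>. Moving from \<open>p\<close> a fraction \<open>t\<close> of the way to \<open>y\<close>
  and dividing the minimality inequality by \<open>t\<close> leaves an error of order \<open>t\<close>, which vanishes as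
  \<open>t\<close> decreases to 0.
\<close>

lemma regularized_minimizer_subdiff:
  fixes f :: "'a::real_inner \<Rightarrow> ereal"
  assumes f: "f \<in> Gamma0" and K: "K > 0" and p: "f p = ereal a"
    and min: "\<And>y b. f y = ereal b \<Longrightarrow> a + K * (norm (p - x))\<^sup>2 \<le> b + K * (norm (y - x))\<^sup>2"
  shows "(2 * K) *\<^sub>R (x - p) \<in> subdiff f p"
proof -
  have "f p + ereal (((2 * K) *\<^sub>R (x - p)) \<bullet> (y - p)) \<le> f y" for y
  proof (cases "f y")
    case (real b)
    have ev: "0 \<le> b - a - 2 * K * ((x - p) \<bullet> (y - p)) + t * (K * (norm (y - p))\<^sup>2)"
      if t: "0 < t" "t < 1" for t
    proof -
      define z where "z = (1 - t) *\<^sub>R p + t *\<^sub>R y"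
      have z: "f z \<le> ereal ((1 - t) * a + t * b)"
        unfolding z_def by (rule Gamma0_convexD[OF f t p real])
      then obtain e where e: "f z = ereal e"
        using Gamma0_not_MInfty[OF f, of z] by (cases "f z") auto
      have "z - x = (p - x) + t *\<^sub>R (y - p)" by (simp add: z_def algebra_simps)
      then have "(norm (z - x))\<^sup>2
          = (norm (p - x))\<^sup>2 + 2 * t * ((p - x) \<bullet> (y - p)) + t\<^sup>2 * (norm (y - p))\<^sup>2"
        by (simp add: power_mult_distrib power2_norm_eq_inner inner_add_left inner_add_right
            inner_diff_left inner_diff_right inner_commute)
          (simp add: power2_eq_square algebra_simps)
      moreover have "(p - x) \<bullet> (y - p) = - ((x - p) \<bullet> (y - p))"
        by (simp flip: inner_minus_left)
      ultimately have "(norm (z - x))\<^sup>2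
          = (norm (p - x))\<^sup>2 - 2 * t * ((x - p) \<bullet> (y - p)) + t\<^sup>2 * (norm (y - p))\<^sup>2"
        by simp
      then have "K * (norm (z - x))\<^sup>2 = K * (norm (p - x))\<^sup>2
          + t * (t * (K * (norm (y - p))\<^sup>2) - 2 * K * ((x - p) \<bullet> (y - p)))"
        by (simp only:) (simp add: power2_eq_square distrib_left right_diff_distrib)
      moreover have "e \<le> a + t * (b - a)" using z e by (simp add: algebra_simps)
      ultimately have "0 \<le> t * (b - a - 2 * K * ((x - p) \<bullet> (y - p)) + t * (K * (norm (y - p))\<^sup>2))"
        using min[OF e] by (simp add: algebra_simps)
      then show ?thesis using t by (simp add: zero_le_mult_iff)
    qed
    have "0 \<le> b - a - 2 * K * ((x - p) \<bullet> (y - p)) + 0 * (K * (norm (y - p))\<^sup>2)"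
    proof (rule tendsto_lowerbound)
      show "((\<lambda>t. b - a - 2 * K * ((x - p) \<bullet> (y - p)) + t * (K * (norm (y - p))\<^sup>2))
          \<longlongrightarrow> b - a - 2 * K * ((x - p) \<bullet> (y - p)) + 0 * (K * (norm (y - p))\<^sup>2)) (at_right 0)"
        by (intro tendsto_intros)
      show "eventually (\<lambda>t. 0 \<le> b - a - 2 * K * ((x - p) \<bullet> (y - p)) + t * (K * (norm (y - p))\<^sup>2))
          (at_right 0)"
        using ev by (auto simp: eventually_at_right_field intro!: exI[of _ 1])
    qed simp
    then show ?thesis using real p by simp
  qed (use Gamma0_not_MInfty[OF f] in auto)
  then show ?thesis unfolding subdiff_def by blast
qed

section \<open>Proximal mappings and firm nonexpansiveness\<close>

lemma prox_rel_iff: "(x, p) \<in> prox_rel f \<longleftrightarrow> x - p \<in> subdiff f p"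
  unfolding prox_rel_def by (auto intro!: exI[of _ "x - p"])

lemma Gamma0_subdiff_finite:
  assumes "f \<in> Gamma0" and "u \<in> subdiff f p"
  obtains a where "f p = ereal a"
proof -
  obtain x b where x: "f x = ereal b" using Gamma0_finite_point[OF assms(1)] .
  have "f p + ereal (u \<bullet> (x - p)) \<le> f x" using assms(2) by (simp add: subdiff_def)
  with x Gamma0_not_MInfty[OF assms(1), of p] that show thesis by (cases "f p") auto
qed

text \<open>
  Add the two subgradient inequalities between \<open>p\<close> and \<open>q\<close>. For \<open>x = y\<close> this says that the
  relation is single-valued.
\<close>

lemma prox_rel_firm:
  fixes f :: "'a::real_inner \<Rightarrow> ereal"
  assumes f: "f \<in> Gamma0" and p: "(x, p) \<in> prox_rel f" and q: "(y, q) \<in> prox_rel f"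
  shows "(norm (p - q))\<^sup>2 \<le> (x - y) \<bullet> (p - q)"
proof -
  note pq = p[unfolded prox_rel_iff] q[unfolded prox_rel_iff]
  obtain a where a: "f p = ereal a" using Gamma0_subdiff_finite[OF f pq(1)] .
  obtain b where b: "f q = ereal b" using Gamma0_subdiff_finite[OF f pq(2)] .
  have "a + (x - p) \<bullet> (q - p) \<le> b" using subdiff_ereal[OF pq(1) a b] .
  moreover have "b + (y - q) \<bullet> (p - q) \<le> a" using subdiff_ereal[OF pq(2) b a] .
  moreover have "(x - y) \<bullet> (p - q) - (norm (p - q))\<^sup>2
      = - ((x - p) \<bullet> (q - p)) - (y - q) \<bullet> (p - q)"
    by (simp add: power2_norm_eq_inner inner_diff_left inner_diff_right inner_commute)
  ultimately show ?thesis by linarith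
qed

text \<open>
  Existence is Moreau's construction: the minimizer of \<open>f + \<parallel>\<cdot> - x\<parallel>\<^sup>2 / 2\<close>.
\<close>

lemma prox_rel_prox:
  fixes f :: "'a::{real_inner, complete_space} \<Rightarrow> ereal"
  assumes f: "f \<in> Gamma0"
  shows "(x, prox f x) \<in> prox_rel f"
proof -
  obtain p a where "f p = ereal a"
    "\<And>y b. f y = ereal b \<Longrightarrow> a + 1/2 * (norm (p - x))\<^sup>2 \<le> b + 1/2 * (norm (y - x))\<^sup>2"
    using Gamma0_regularized_minimizer[OF f, of "1/2" x] by auto
  then have p: "(x, p) \<in> prox_rel f"
    using regularized_minimizer_subdiff[OF f, of "1/2" p a x] by (simp add: prox_rel_iff)
  have "q = p" if "(x, q) \<in> prox_rel f" for q
    using prox_rel_firm[OF f that p] by simp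
  then show ?thesis unfolding prox_def using theI[of "\<lambda>p. (x, p) \<in> prox_rel f"] p by blast
qed

lemma prox_eqI:
  fixes f :: "'a::{real_inner, complete_space} \<Rightarrow> ereal"
  assumes "f \<in> Gamma0" and "(x, p) \<in> prox_rel f"
  shows "prox f x = p"
  using prox_rel_firm[OF assms(1) prox_rel_prox[OF assms(1)] assms(2), of x] by simp

lemma prox_Firm: "f \<in> Gamma0 \<Longrightarrow> prox f \<in> Firm"
  for f :: "'a::{real_inner, complete_space} \<Rightarrow> ereal"
  unfolding Firm_def using prox_rel_firm prox_rel_prox by blast

lemma Firm_nonexpansive:
  assumes "T \<in> Firm"
  shows "norm (T x - T y) \<le> norm (x - y)"
proof -
  have "(norm (T x - T y))\<^sup>2 \<le> norm (x - y) * norm (T x - T y)"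
    using assms norm_cauchy_schwarz[of "x - y" "T x - T y"] order_trans unfolding Firm_def by blast
  then show ?thesis
    by (cases "norm (T x - T y) = 0") (simp_all add: power2_eq_square)
qed

lemma Firm_monotone: "T \<in> Firm \<Longrightarrow> 0 \<le> (x - y) \<bullet> (T x - T y)"
  unfolding Firm_def by (auto intro: order_trans[OF zero_le_power2])

text \<open>
  The right-hand side is \<open>(x - y) \<bullet> (x - y)\<close>, so this is monotonicity of \<open>Id - T\<close>.
\<close>

lemma Firm_complement_monotone:
  assumes "T \<in> Firm"
  shows "(x - y) \<bullet> (T x - T y) \<le> (norm (x - y))\<^sup>2"
proof -
  have "(x - y) \<bullet> (T x - T y) \<le> norm (x - y) * norm (T x - T y)"
    by (rule norm_cauchy_schwarz)
  also have "\<dots> \<le> norm (x - y) * norm (x - y)"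
    by (intro mult_left_mono Firm_nonexpansive assms norm_ge_zero)
  finally show ?thesis by (simp add: power2_eq_square)
qed

section \<open>Proximal mappings as gradients\<close>

text \<open>
  This is the Fenchel conjugate \<open>(f + \<parallel>\<cdot>\<parallel>\<^sup>2 / 2)\<^sup>*\<close> at \<open>z\<close>, written through the point \<open>prox f z\<close> at which
  the supremum is attained. For \<open>f \<in> Gamma0\<close> the value \<open>f (prox f z)\<close> is finite, so the
  conversion to a real number loses nothing.
\<close>

definition prox_potential :: "('a::{real_inner, complete_space} \<Rightarrow> ereal) \<Rightarrow> 'a \<Rightarrow> real" where
  "prox_potential f z = z \<bullet> prox f z - real_of_ereal (f (prox f z)) - (norm (prox f z))\<^sup>2 / 2"

lemma prox_potential_eq:
  assumes "f \<in> Gamma0" and "(z, p) \<in> prox_rel f" and "f p = ereal a"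
  shows "prox_potential f z = z \<bullet> p - a - (norm p)\<^sup>2 / 2"
  using prox_eqI[OF assms(1,2)] assms(3) by (simp add: prox_potential_def)

text \<open>
  The Fenchel-Young inequality: \<open>z - prox f z\<close> is a subgradient of \<open>f\<close> at \<open>prox f z\<close>, and completing
  the square leaves the nonnegative remainder \<open>\<parallel>y - prox f z\<parallel>\<^sup>2 / 2\<close>.
\<close>

lemma prox_potential_Young:
  assumes f: "f \<in> Gamma0" and y: "f y = ereal b"
  shows "z \<bullet> y - prox_potential f z \<le> b + (norm y)\<^sup>2 / 2"
proof -
  define p where "p = prox f z"
  have p: "(z, p) \<in> prox_rel f" unfolding p_def by (rule prox_rel_prox[OF f])
  note u = p[unfolded prox_rel_iff]
  obtain a where a: "f p = ereal a" using Gamma0_subdiff_finite[OF f u] .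
  have "a + (z - p) \<bullet> (y - p) \<le> b" using subdiff_ereal[OF u a y] .
  moreover have "(z - p) \<bullet> (y - p) = z \<bullet> y - z \<bullet> p + (norm p)\<^sup>2 / 2 - (norm y)\<^sup>2 / 2 + (norm (y - p))\<^sup>2 / 2"
    by (simp add: power2_norm_eq_inner inner_diff_left inner_diff_right inner_commute field_simps)
  ultimately show ?thesis
    using prox_potential_eq[OF f p a] zero_le_power2[of "norm (y - p)"] by linarith
qed

text \<open>
  Fenchel-Young at \<open>z\<close> and the point \<open>prox f x\<close>, where equality holds for \<open>x\<close>.
\<close>

lemma prox_potential_subgradient:
  assumes f: "f \<in> Gamma0"
  shows "prox_potential f x + prox f x \<bullet> (z - x) \<le> prox_potential f z"
proof -
  have p: "(x, prox f x) \<in> prox_rel f" by (rule prox_rel_prox[OF f])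
  obtain a where a: "f (prox f x) = ereal a"
    using Gamma0_subdiff_finite[OF f p[unfolded prox_rel_iff]] .
  show ?thesis
    using prox_potential_Young[OF f a, of z] prox_potential_eq[OF f p a]
    by (simp add: inner_diff_right inner_commute)
qed

text \<open>
  The subgradient inequalities at \<open>x\<close> and at \<open>z\<close> enclose \<open>h z - h x - P x \<bullet> (z - x)\<close> between 0 and
  \<open>(P z - P x) \<bullet> (z - x)\<close>, which is at most \<open>\<parallel>z - x\<parallel>\<^sup>2\<close>.
\<close>

lemma has_derivative_nonexpansive_subgradient:
  fixes h :: "'a::real_inner \<Rightarrow> real"
  assumes sub: "\<And>x z. h x + P x \<bullet> (z - x) \<le> h z"
    and lip: "\<And>x z. norm (P x - P z) \<le> norm (x - z)"
  shows "(h has_derivative (\<lambda>v. P x \<bullet> v)) (at x)"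
proof (rule has_derivativeI_sandwich[where e = 1 and H = "\<lambda>z. norm (z - x)"])
  show "bounded_linear ((\<bullet>) (P x))" by (rule bounded_linear_inner_right)
  fix z assume "z \<noteq> x"
  have lower: "0 \<le> h z - h x - P x \<bullet> (z - x)" using sub[of x z] by simp
  have "h z - h x - P x \<bullet> (z - x) \<le> (P z - P x) \<bullet> (z - x)"
    using sub[of z x] by (simp add: inner_diff_left inner_diff_right)
  also have "\<dots> \<le> norm (P z - P x) * norm (z - x)" by (rule norm_cauchy_schwarz)
  also have "\<dots> \<le> norm (z - x) * norm (z - x)" by (intro mult_right_mono lip norm_ge_zero)
  finally show "norm (h z - h x - P x \<bullet> (z - x)) / norm (z - x) \<le> norm (z - x)"
    using lower \<open>z \<noteq> x\<close> by (simp add: field_simps)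
next
  have "((\<lambda>z. norm (z - x)) \<longlongrightarrow> norm (x - x)) (at x)" by (intro tendsto_intros)
  then show "((\<lambda>z. norm (z - x)) \<longlongrightarrow> 0) (at x)" by simp
qed simp

lemma prox_potential_has_derivative:
  assumes "f \<in> Gamma0"
  shows "(prox_potential f has_derivative (\<lambda>v. prox f x \<bullet> v)) (at x)"
  by (rule has_derivative_nonexpansive_subgradient
      [OF prox_potential_subgradient[OF assms] Firm_nonexpansive[OF prox_Firm[OF assms]]])

section \<open>The Baillon-Haddad theorem\<close>

lemma gradient_mean_value:
  fixes H :: "'a::real_inner \<Rightarrow> real"
  assumes der: "\<And>x. (H has_derivative (\<lambda>v. S x \<bullet> v)) (at x)"
  obtains t where "0 < t" "t < 1" "H z - H x = S (x + t *\<^sub>R (z - x)) \<bullet> (z - x)"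
proof -
  have "((\<lambda>t. H (x + t *\<^sub>R (z - x))) has_derivative
      (\<lambda>s. S (x + t *\<^sub>R (z - x)) \<bullet> (s *\<^sub>R (z - x)))) (at t)" for t
    by (rule has_derivative_compose[OF _ der]) (auto intro!: derivative_eq_intros)
  then have "((\<lambda>t. H (x + t *\<^sub>R (z - x))) has_real_derivative
      S (x + t *\<^sub>R (z - x)) \<bullet> (z - x)) (at t)" for t
    by (simp add: has_field_derivative_def mult_commute_abs)
  then obtain t where "0 < t" "t < 1"
    "H (x + 1 *\<^sub>R (z - x)) - H (x + 0 *\<^sub>R (z - x)) = (1 - 0) * (S (x + t *\<^sub>R (z - x)) \<bullet> (z - x))"
    using MVT2[of 0 1 "\<lambda>t. H (x + t *\<^sub>R (z - x))" "\<lambda>t. S (x + t *\<^sub>R (z - x)) \<bullet> (z - x)"] by auto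
  with that show thesis by simp
qed

lemma monotone_gradient_le:
  fixes H :: "'a::real_inner \<Rightarrow> real"
  assumes der: "\<And>x. (H has_derivative (\<lambda>v. S x \<bullet> v)) (at x)"
    and mono: "\<And>x y. 0 \<le> (x - y) \<bullet> (S x - S y)"
  shows "H x + S x \<bullet> (z - x) \<le> H z"
proof -
  obtain t where t: "0 < t" "t < 1" "H z - H x = S (x + t *\<^sub>R (z - x)) \<bullet> (z - x)"
    using gradient_mean_value[OF der] .
  have "0 \<le> t * ((z - x) \<bullet> (S (x + t *\<^sub>R (z - x)) - S x))"
    using mono[of "x + t *\<^sub>R (z - x)" x] by simp
  then have "0 \<le> (z - x) \<bullet> (S (x + t *\<^sub>R (z - x)) - S x)"
    using t(1) by (simp add: zero_le_mult_iff)
  with t(3) show ?thesis by (simp add: inner_diff_right inner_commute)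
qed

text \<open>
  Monotonicity of \<open>S\<close> makes \<open>H\<close> convex, and monotonicity of \<open>Id - S\<close> makes \<open>\<parallel>\<cdot>\<parallel>\<^sup>2 / 2 - H\<close> convex. So \<open>H\<close>
  lies above its tangent at \<open>x\<close> and below a paraboloid that touches it at \<open>y\<close>. The comparison of
  the two at one well-chosen point improves the tangent inequality by \<open>\<parallel>S x - S y\<parallel>\<^sup>2 / 2\<close>;
  exchanging \<open>x\<close> and \<open>y\<close> and adding gives the claim.
\<close>

lemma Baillon_Haddad:
  fixes H :: "'a::real_inner \<Rightarrow> real"
  assumes der: "\<And>x. (H has_derivative (\<lambda>v. S x \<bullet> v)) (at x)"
    and mono: "\<And>x y. 0 \<le> (x - y) \<bullet> (S x - S y)"
    and comono: "\<And>x y. (x - y) \<bullet> (S x - S y) \<le> (norm (x - y))\<^sup>2"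
  shows "S \<in> Firm"
proof -
  have below: "H x + S x \<bullet> (z - x) \<le> H z" for x z
    using monotone_gradient_le[OF der mono] .
  have above: "H z \<le> H y + S y \<bullet> (z - y) + (norm (z - y))\<^sup>2 / 2" for y z
  proof -
    have "y \<bullet> y / 2 - H y + (y - S y) \<bullet> (z - y) \<le> z \<bullet> z / 2 - H z"
    proof (rule monotone_gradient_le[where H = "\<lambda>x. x \<bullet> x / 2 - H x" and S = "\<lambda>x. x - S x"])
      show "((\<lambda>x. x \<bullet> x / 2 - H x) has_derivative (\<lambda>v. (x - S x) \<bullet> v)) (at x)" for x
        by (auto intro!: derivative_eq_intros der
            simp: inner_diff_left inner_diff_right inner_commute fun_eq_iff)
      show "0 \<le> (x - y) \<bullet> ((x - S x) - (y - S y))" for x y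
        using comono[of x y] 
        by (simp add: power2_norm_eq_inner inner_diff_left inner_diff_right)
    qed
    then show ?thesis
      by (simp add: power2_norm_eq_inner inner_diff_left inner_diff_right inner_commute field_simps)
  qed
  have gap: "H x + S x \<bullet> (y - x) + (norm (S x - S y))\<^sup>2 / 2 \<le> H y" for x y
  proof -
    \<comment> \<open>The minimizer of the paraboloid at \<open>y\<close> minus the tangent at \<open>x\<close>.\<close>
    define z where "z = y + (S x - S y)"
    have "H x + S x \<bullet> (z - x) \<le> H y + S y \<bullet> (z - y) + (norm (z - y))\<^sup>2 / 2"
      using below above order_trans by blast
    then show ?thesis
      by (simp add: z_def power2_norm_eq_inner inner_add_left inner_add_right inner_diff_left
          inner_diff_right inner_commute field_simps)
  qed
  have "(norm (S x - S y))\<^sup>2 \<le> (x - y) \<bullet> (S x - S y)" for x y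
    using gap[of x y] gap[of y x] 
    by (simp add: norm_minus_commute inner_diff_left inner_diff_right inner_commute)
  then show ?thesis unfolding Firm_def by blast
qed

section \<open>Recovering a function from its proximal mapping\<close>

text \<open>
  Minimize \<open>f + K \<parallel>\<cdot> - y\<parallel>\<^sup>2\<close> with \<open>K\<close> large. The minimizer \<open>p\<close> carries the subgradient \<open>u = 2 K (y - p)\<close>
  of \<open>f\<close>, so \<open>p\<close> is the proximal point of \<open>z = p + u\<close>. For \<open>K \<ge> 1/2\<close> the value at \<open>y\<close> of the minorant
  \<open>z \<bullet> _ - prox_potential f z - \<parallel>_\<parallel>\<^sup>2 / 2\<close> of \<open>f\<close> is at least the minimal value \<open>f p + K \<parallel>p - y\<parallel>\<^sup>2\<close>. That value exceeds \<open>r\<close>: if \<open>p\<close>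
  is near \<open>y\<close>, by lower semicontinuity, and otherwise because the quadratic term beats the cone
  minorant.
\<close>

lemma prox_potential_exceeds:
  fixes f :: "'a::{real_inner, complete_space} \<Rightarrow> ereal"
  assumes f: "f \<in> Gamma0" and r: "ereal r < f y"
  obtains z where "r < z \<bullet> y - prox_potential f z - (norm y)\<^sup>2 / 2"
proof -
  obtain d where d: "d > 0" "\<And>p. dist p y < d \<Longrightarrow> ereal r < f p"
    using lsc_less_nhds[of f "ereal r" y] r f unfolding Gamma0_def by blast
  obtain a b where b: "b \<ge> 0" and minor: "\<forall>p. ereal (a - b * norm (p - y)) \<le> f p"
    using Gamma0_cone_minorant[OF f, where x = y] .
  \<comment> \<open>For \<open>s \<ge> d\<close> the summands times \<open>s\<^sup>2\<close> outweigh 0, \<open>b s\<close> and \<open>r - a\<close>, respectively.\<close>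
  define K where "K = 1 / 2 + b / d + \<bar>r - a\<bar> / d\<^sup>2"
  have K: "K \<ge> 1 / 2" using b d(1) by (simp add: K_def)
  then have "K > 0" by simp
  obtain p c where p: "f p = ereal c"
    and min: "\<And>w e. f w = ereal e \<Longrightarrow> c + K * (norm (p - y))\<^sup>2 \<le> e + K * (norm (w - y))\<^sup>2"
    using Gamma0_regularized_minimizer[OF f \<open>K > 0\<close>, of y] by blast
  have large: "r < c + K * (norm (p - y))\<^sup>2"
  proof (cases "dist p y < d")
    case True
    then have "r < c" using d(2)[of p] p by simp
    moreover have "0 \<le> K * (norm (p - y))\<^sup>2" using \<open>K > 0\<close> by simp
    ultimately show ?thesis by linarith
  next
    case False
    define s where "s = norm (p - y)"
    have s: "s \<ge> d" using False by (simp add: s_def dist_norm)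
    have "a - b * s \<le> c" using minor p by (metis ereal_less_eq(3) s_def)
    moreover have "b * s \<le> b / d * s\<^sup>2"
    proof -
      have "b * s * d \<le> b * s * s" using b s d(1) by (intro mult_left_mono) auto
      then show ?thesis using d(1) by (simp add: field_simps power2_eq_square)
    qed
    moreover have "\<bar>r - a\<bar> \<le> \<bar>r - a\<bar> / d\<^sup>2 * s\<^sup>2"
    proof -
      have "\<bar>r - a\<bar> * d\<^sup>2 \<le> \<bar>r - a\<bar> * s\<^sup>2" using s d(1) by (intro mult_left_mono power_mono) auto
      then show ?thesis using d(1) by (simp add: field_simps)
    qed
    moreover have "1 / 2 * s\<^sup>2 > 0" using s d(1) by simp
    moreover have "K * s\<^sup>2 = 1 / 2 * s\<^sup>2 + b / d * s\<^sup>2 + \<bar>r - a\<bar> / d\<^sup>2 * s\<^sup>2"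
      by (simp only: K_def distrib_right)
    ultimately show ?thesis unfolding s_def by linarith
  qed
  define u where "u = (2 * K) *\<^sub>R (y - p)"
  have "u \<in> subdiff f p"
    unfolding u_def using regularized_minimizer_subdiff[OF f \<open>K > 0\<close> p min] .
  then have "(p + u, p) \<in> prox_rel f" by (simp add: prox_rel_iff)
  then have "(p + u) \<bullet> y - prox_potential f (p + u) - (norm y)\<^sup>2 / 2
      = (p + u) \<bullet> y - ((p + u) \<bullet> p - c - (norm p)\<^sup>2 / 2) - (norm y)\<^sup>2 / 2"
    using prox_potential_eq[OF f _ p] by simp
  also have "\<dots> = c + u \<bullet> (y - p) - (norm (y - p))\<^sup>2 / 2"
    by (simp add: power2_norm_eq_inner inner_add_left inner_add_right inner_diff_left
        inner_diff_right inner_commute field_simps)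
  also have "\<dots> = c + (2 * K - 1 / 2) * (norm (p - y))\<^sup>2"
  proof -
    have "u \<bullet> (y - p) = 2 * K * (norm (p - y))\<^sup>2"
      unfolding u_def inner_scaleR_left by (metis norm_minus_commute power2_norm_eq_inner)
    then show ?thesis by (simp add: norm_minus_commute left_diff_distrib)
  qed
  finally have "(p + u) \<bullet> y - prox_potential f (p + u) - (norm y)\<^sup>2 / 2
      = c + (2 * K - 1 / 2) * (norm (p - y))\<^sup>2" .
  moreover have "K * (norm (p - y))\<^sup>2 \<le> (2 * K - 1 / 2) * (norm (p - y))\<^sup>2"
    using K by (intro mult_right_mono) auto
  ultimately show thesis using that[of "p + u"] large by linarith
qed

text \<open>
  The Fenchel-Moreau identity \<open>f + \<parallel>\<cdot>\<parallel>\<^sup>2 / 2 = (f + \<parallel>\<cdot>\<parallel>\<^sup>2 / 2)\<^sup>*\<^sup>*\<close>: a function in \<open>Gamma0\<close> is determined by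
  its potential.
\<close>

lemma Gamma0_eq_SUP_prox_potential:
  fixes f :: "'a::{real_inner, complete_space} \<Rightarrow> ereal"
  assumes f: "f \<in> Gamma0"
  shows "f y = (SUP z. ereal (z \<bullet> y - prox_potential f z - (norm y)\<^sup>2 / 2))"
    (is "_ = ?S")
proof (rule antisym)
  show "?S \<le> f y"
  proof (rule SUP_least)
    fix z
    show "ereal (z \<bullet> y - prox_potential f z - (norm y)\<^sup>2 / 2) \<le> f y"
      using prox_potential_Young[OF f, of y _ z] Gamma0_not_MInfty[OF f, of y]
      by (cases "f y") (auto simp: algebra_simps)
  qed
  show "f y \<le> ?S"
  proof (rule ccontr)
    assume "\<not> ?thesis"
    then obtain r where r: "?S < ereal r" "ereal r < f y"
      using ereal_dense2[of ?S "f y"] by (auto simp: not_le)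
    obtain z where z: "r < z \<bullet> y - prox_potential f z - (norm y)\<^sup>2 / 2"
      using prox_potential_exceeds[OF f r(2)] .
    have "ereal (z \<bullet> y - prox_potential f z - (norm y)\<^sup>2 / 2) \<le> ?S"
      by (rule SUP_upper) simp
    also note r(1)
    finally show False using z by simp
  qed
qed

text \<open>
  The potentials differ by the affine function \<open>\<langle>c, \<cdot>\<rangle> + k\<close>, because their gradients differ by \<open>c\<close>.
  Under conjugation an added linear function becomes a translation by \<open>c\<close>; the term \<open>\<langle>c, y\<rangle>\<close>
  arises from \<open>\<parallel>y - c\<parallel>\<^sup>2 / 2 - \<parallel>y\<parallel>\<^sup>2 / 2\<close>.
\<close>

lemma Gamma0_sim_if_prox_diff_const:
  fixes f g :: "'a::{real_inner, complete_space} \<Rightarrow> ereal"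
  assumes f: "f \<in> Gamma0" and g: "g \<in> Gamma0" and c: "\<And>x. prox g x - prox f x = c"
  shows "(f, g) \<in> Gamma0_sim"
proof -
  let ?h = "prox_potential f"
  have der: "((\<lambda>x. prox_potential g x - ?h x) has_derivative (\<lambda>v. c \<bullet> v)) (at x)" for x
    using has_derivative_diff[OF prox_potential_has_derivative[OF g, of x]
        prox_potential_has_derivative[OF f, of x]]
    by (simp flip: inner_diff_left add: c)
  define k where "k = prox_potential g 0 - ?h 0"
  have pot: "prox_potential g z = ?h z + c \<bullet> z + k" for z
  proof -
    have "(prox_potential g z - ?h z) - (prox_potential g 0 - ?h 0) = c \<bullet> (z - 0)"
      using gradient_mean_value[where S = "\<lambda>_. c", OF der, of z 0] by blast
    then show ?thesis by (simp add: k_def)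
  qed
  have "g y = f (y - c) - ereal (c \<bullet> y) + ereal ((norm c)\<^sup>2 / 2 - k)" for y
  proof -
    have "z \<bullet> y - prox_potential g z - (norm y)\<^sup>2 / 2
        = z \<bullet> (y - c) - ?h z - (norm (y - c))\<^sup>2 / 2 + ((norm c)\<^sup>2 / 2 - c \<bullet> y - k)" for z
      by (simp add: pot power2_norm_eq_inner inner_diff_left inner_diff_right
          inner_commute field_simps)
    then have "g y = (SUP z. ereal (z \<bullet> (y - c) - ?h z - (norm (y - c))\<^sup>2 / 2)
        + ereal ((norm c)\<^sup>2 / 2 - c \<bullet> y - k))"
      unfolding Gamma0_eq_SUP_prox_potential[OF g, of y] by simp
    also have "\<dots> = f (y - c) + ereal ((norm c)\<^sup>2 / 2 - c \<bullet> y - k)"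
      unfolding Gamma0_eq_SUP_prox_potential[OF f, of "y - c"]
      by (rule SUP_ereal_add_left) auto
    also have "\<dots> = f (y - c) - ereal (c \<bullet> y) + ereal ((norm c)\<^sup>2 / 2 - k)"
      by (cases "f (y - c)") auto
    finally show ?thesis .
  qed
  then show ?thesis unfolding Gamma0_sim_def using f g by blast
qed

text \<open>
  Translating \<open>f\<close> by \<open>c\<close> and subtracting \<open>\<langle>c, \<cdot>\<rangle>\<close> carries a subgradient \<open>u\<close> at \<open>p\<close> to the subgradient
  \<open>u - c\<close> at \<open>p + c\<close>; the sum \<open>p + u\<close> does not change.
\<close>

lemma prox_diff_const_if_Gamma0_sim:
  fixes f g :: "'a::{real_inner, complete_space} \<Rightarrow> ereal"
  assumes "(f, g) \<in> Gamma0_sim"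
  obtains c where "\<And>x. prox g x - prox f x = c"
proof -
  obtain c \<gamma> where f: "f \<in> Gamma0" and g: "g \<in> Gamma0"
    and eq: "\<And>x. g x = f (x - c) - ereal (c \<bullet> x) + ereal \<gamma>"
    using assms unfolding Gamma0_sim_def by blast
  have "prox g x - prox f x = c" for x
  proof -
    define p where "p = prox f x"
    have u: "x - p \<in> subdiff f p"
      using prox_rel_prox[OF f, of x] by (simp add: p_def prox_rel_iff)
    obtain a where a: "f p = ereal a" using Gamma0_subdiff_finite[OF f u] .
    have "g (p + c) + ereal ((x - (p + c)) \<bullet> (y - (p + c))) \<le> g y" for y
    proof (cases "f (y - c)")
      case (real b)
      have "a + (x - p) \<bullet> (y - c - p) \<le> b" using subdiff_ereal[OF u a real] .
      moreover have "y - (p + c) = y - c - p" "x - (p + c) = x - p - c" by simp_all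
      ultimately show ?thesis using a real
        by (simp add: eq inner_diff_left inner_diff_right inner_add_left inner_add_right
            inner_commute)
    qed (use Gamma0_not_MInfty[OF f] in \<open>auto simp: eq\<close>)
    then have "(x, p + c) \<in> prox_rel g" by (simp add: prox_rel_iff subdiff_def)
    then show ?thesis using prox_eqI[OF g] by (simp add: p_def)
  qed
  with that show thesis by blast
qed

lemma Gamma0_sim_iff_prox:
  fixes f g :: "'a::{real_inner, complete_space} \<Rightarrow> ereal"
  assumes "f \<in> Gamma0" and "g \<in> Gamma0"
  shows "(f, g) \<in> Gamma0_sim \<longleftrightarrow> (prox f, prox g) \<in> Firm_sim"
proof
  assume "(f, g) \<in> Gamma0_sim"
  then obtain c where "\<And>x. prox g x - prox f x = c"
    using prox_diff_const_if_Gamma0_sim by blast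
  then show "(prox f, prox g) \<in> Firm_sim"
    using assms prox_Firm by (auto simp: Firm_sim_def)
next
  assume "(prox f, prox g) \<in> Firm_sim"
  then show "(f, g) \<in> Gamma0_sim"
    using Gamma0_sim_if_prox_diff_const[OF assms] by (auto simp: Firm_sim_def)
qed

section \<open>The order on equivalence classes\<close>

lemma firm_le_cong:
  assumes "(T1, S1) \<in> Firm_sim" and "(T2, S2) \<in> Firm_sim" and "firm_le T1 T2"
  shows "firm_le S1 S2"
proof -
  obtain c d where c: "\<And>x. S1 x - T1 x = c" and d: "\<And>x. S2 x - T2 x = d"
    using assms(1,2) by (auto simp: Firm_sim_def)
  have "S2 x - S1 x = T2 x - T1 x + (d - c)" for x
    by (simp add: algebra_simps flip: c[of x] d[of x])
  with assms(3) show ?thesis by (simp add: firm_le_def Firm_def)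
qed

lemma Firm_class_le_iff:
  assumes T: "T1 \<in> Firm" "T2 \<in> Firm"
  shows "(Firm_sim `` {T1}, Firm_sim `` {T2}) \<in> Firm_class_le \<longleftrightarrow> firm_le T1 T2"
proof
  assume "(Firm_sim `` {T1}, Firm_sim `` {T2}) \<in> Firm_class_le"
  then obtain S1 S2 where S: "S1 \<in> Firm" "S2 \<in> Firm" "firm_le S1 S2"
    and "Firm_sim `` {S1} = Firm_sim `` {T1}" "Firm_sim `` {S2} = Firm_sim `` {T2}"
    by (auto simp: Firm_class_le_def)
  then have "(S1, T1) \<in> Firm_sim" "(S2, T2) \<in> Firm_sim"
    using T eq_equiv_class[OF _ equiv_Firm_sim] by blast+
  then show "firm_le T1 T2" using firm_le_cong S(3) by blast
qed (use T in \<open>auto simp: Firm_class_le_def\<close>)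

lemma Gamma0_class_le_iff:
  fixes f g :: "'a::{real_inner, complete_space} \<Rightarrow> ereal"
  assumes f: "f \<in> Gamma0" and g: "g \<in> Gamma0"
  shows "(Gamma0_sim `` {g}, Gamma0_sim `` {f}) \<in> Gamma0_class_le \<longleftrightarrow> firm_le (prox f) (prox g)"
proof
  assume "(Gamma0_sim `` {g}, Gamma0_sim `` {f}) \<in> Gamma0_class_le"
  then obtain g' f' where g': "g' \<in> Gamma0" "Gamma0_sim `` {g'} = Gamma0_sim `` {g}"
    and f': "f' \<in> Gamma0" "Gamma0_sim `` {f'} = Gamma0_sim `` {f}"
    and le: "(Firm_sim `` {prox f'}, Firm_sim `` {prox g'}) \<in> Firm_class_le"
    by (auto simp: Gamma0_class_le_def)
  have "(g', g) \<in> Gamma0_sim" "(f', f) \<in> Gamma0_sim"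
    using eq_equiv_class[OF _ equiv_Gamma0_sim] g f g' f' by blast+
  then have "(prox g', prox g) \<in> Firm_sim" "(prox f', prox f) \<in> Firm_sim"
    using Gamma0_sim_iff_prox g f g' f' by blast+
  moreover have "firm_le (prox f') (prox g')"
    using le Firm_class_le_iff prox_Firm f' g' by blast
  ultimately show "firm_le (prox f) (prox g)" using firm_le_cong by blast
next
  assume "firm_le (prox f) (prox g)"
  then have "(Firm_sim `` {prox f}, Firm_sim `` {prox g}) \<in> Firm_class_le"
    using Firm_class_le_iff prox_Firm f g by blast
  with f g show "(Gamma0_sim `` {g}, Gamma0_sim `` {f}) \<in> Gamma0_class_le"
    unfolding Gamma0_class_le_def by blast
qed

text \<open>
  Here the gradient structure is essential: firm nonexpansiveness of the difference follows from
  Baillon-Haddad with the potential \<open>h\<^sub>k - h\<^sub>f\<close>. Its upper bound comes from the monotonicity of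
  \<open>Id - prox k\<close> and of \<open>prox f\<close>.
\<close>

lemma firm_le_prox_trans:
  fixes f g k :: "'a::{real_inner, complete_space} \<Rightarrow> ereal"
  assumes f: "f \<in> Gamma0" and k: "k \<in> Gamma0"
    and fg: "firm_le (prox f) (prox g)" and gk: "firm_le (prox g) (prox k)"
  shows "firm_le (prox f) (prox k)"
  unfolding firm_le_def
proof (rule Baillon_Haddad)
  show "((\<lambda>x. prox_potential k x - prox_potential f x) has_derivative
      (\<lambda>v. (prox k x - prox f x) \<bullet> v)) (at x)" for x
    using has_derivative_diff[OF prox_potential_has_derivative[OF k, of x]
        prox_potential_has_derivative[OF f, of x]]
    by (simp add: inner_diff_left)
  fix x y :: 'a
  let ?D = "\<lambda>T::'a \<Rightarrow> 'a. (x - y) \<bullet> (T x - T y)"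
  have split: "?D (\<lambda>x. prox k x - prox f x) = ?D (prox k) - ?D (prox f)"
    by (simp add: inner_diff_right)
  have "0 \<le> ?D (\<lambda>x. prox g x - prox f x)" "0 \<le> ?D (\<lambda>x. prox k x - prox g x)"
    using Firm_monotone[OF fg[unfolded firm_le_def]] Firm_monotone[OF gk[unfolded firm_le_def]]
    by blast+
  then show "0 \<le> ?D (\<lambda>x. prox k x - prox f x)" by (simp add: inner_diff_right)
  show "?D (\<lambda>x. prox k x - prox f x) \<le> (norm (x - y))\<^sup>2"
    unfolding split using Firm_monotone[OF prox_Firm[OF f], of x y]
      Firm_complement_monotone[OF prox_Firm[OF k], of x y] by linarith
qed

text \<open>
  If \<open>T2 - T1\<close> is firmly nonexpansive and \<open>T1 - T2\<close> is monotone, then the squared norm of any increment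
  of \<open>T2 - T1\<close> is bounded by a nonpositive number.
\<close>

lemma firm_le_antisym:
  assumes T: "T1 \<in> Firm" "T2 \<in> Firm" and le: "firm_le T1 T2" "firm_le T2 T1"
  shows "(T1, T2) \<in> Firm_sim"
proof -
  have "T2 x - T1 x = T2 0 - T1 0" for x
  proof -
    let ?D = "(T2 x - T1 x) - (T2 0 - T1 0)"
    have "(norm ?D)\<^sup>2 \<le> (x - 0) \<bullet> ?D"
      using le(1) unfolding firm_le_def Firm_def by blast
    moreover have "0 \<le> (x - 0) \<bullet> ((T1 x - T2 x) - (T1 0 - T2 0))"
      using Firm_monotone[OF le(2)[unfolded firm_le_def], of x 0] .
    moreover have "(x - 0) \<bullet> ((T1 x - T2 x) - (T1 0 - T2 0)) = - ((x - 0) \<bullet> ?D)"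
      by (simp add: inner_diff_right)
    ultimately have "(norm ?D)\<^sup>2 \<le> 0" by linarith
    then show ?thesis by simp
  qed
  with T show ?thesis unfolding Firm_sim_def by blast
qed

theorem theorem9p3:
  shows "(\<forall>f \<in> (Gamma0 :: ('a::{real_inner, complete_space} \<Rightarrow> ereal) set). \<forall>g \<in> Gamma0.
            ((Gamma0_sim `` {g}, Gamma0_sim `` {f}) \<in> Gamma0_class_le
               \<longleftrightarrow> (Firm_sim `` {prox f}, Firm_sim `` {prox g}) \<in> Firm_class_le)
          \<and> ((Firm_sim `` {prox f}, Firm_sim `` {prox g}) \<in> Firm_class_le
               \<longleftrightarrow> firm_le (prox f) (prox g)))
       \<and> partial_order_on (Gamma0 // (Gamma0_sim :: (('a \<Rightarrow> ereal) \<times> ('a \<Rightarrow> ereal)) set))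
           Gamma0_class_le"
proof
  show "\<forall>f \<in> (Gamma0 :: ('a \<Rightarrow> ereal) set). \<forall>g \<in> Gamma0.
            ((Gamma0_sim `` {g}, Gamma0_sim `` {f}) \<in> Gamma0_class_le
               \<longleftrightarrow> (Firm_sim `` {prox f}, Firm_sim `` {prox g}) \<in> Firm_class_le)
          \<and> ((Firm_sim `` {prox f}, Firm_sim `` {prox g}) \<in> Firm_class_le
               \<longleftrightarrow> firm_le (prox f) (prox g))"
    by (simp add: Gamma0_class_le_iff Firm_class_le_iff prox_Firm)
  let ?Q = "Gamma0 // (Gamma0_sim :: (('a \<Rightarrow> ereal) \<times> ('a \<Rightarrow> ereal)) set)"
  let ?le = "Gamma0_class_le :: (('a \<Rightarrow> ereal) set \<times> ('a \<Rightarrow> ereal) set) set"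
  have sub: "?le \<subseteq> ?Q \<times> ?Q"
    by (auto simp: Gamma0_class_le_def intro: quotientI)
  have "refl_on ?Q ?le"
  proof (rule refl_onI)
    fix A assume "A \<in> ?Q"
    then obtain f where f: "f \<in> Gamma0" "A = Gamma0_sim `` {f}" by (rule quotientE)
    have "firm_le (prox f) (prox f)" by (simp add: firm_le_def Firm_def)
    with f show "(A, A) \<in> ?le" by (simp add: Gamma0_class_le_iff)
  qed
  moreover have "trans ?le"
  proof (rule transI)
    fix A B C assume AB: "(A, B) \<in> ?le" and BC: "(B, C) \<in> ?le"
    with sub have "A \<in> ?Q" "B \<in> ?Q" "C \<in> ?Q" by auto
    then obtain f g k where fgk: "f \<in> Gamma0" "g \<in> Gamma0" "k \<in> Gamma0"
      and ABC: "A = Gamma0_sim `` {f}" "B = Gamma0_sim `` {g}" "C = Gamma0_sim `` {k}"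
      by (auto elim!: quotientE)
    then have "firm_le (prox k) (prox g)" "firm_le (prox g) (prox f)"
      using AB BC by (simp_all add: Gamma0_class_le_iff)
    then have "firm_le (prox k) (prox f)" using firm_le_prox_trans fgk by blast
    then show "(A, C) \<in> ?le" using fgk ABC by (simp add: Gamma0_class_le_iff)
  qed
  moreover have "antisym ?le"
  proof (rule antisymI)
    fix A B assume AB: "(A, B) \<in> ?le" and BA: "(B, A) \<in> ?le"
    with sub have "A \<in> ?Q" "B \<in> ?Q" by auto
    then obtain f g where fg: "f \<in> Gamma0" "g \<in> Gamma0"
      and AB_eq: "A = Gamma0_sim `` {f}" "B = Gamma0_sim `` {g}"
      by (auto elim!: quotientE)
    then have "firm_le (prox f) (prox g)" "firm_le (prox g) (prox f)"
      using AB BA by (simp_all add: Gamma0_class_le_iff)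
    then have "(f, g) \<in> Gamma0_sim"
      using firm_le_antisym prox_Firm Gamma0_sim_iff_prox fg by blast
    then show "A = B" unfolding AB_eq by (rule equiv_class_eq[OF equiv_Gamma0_sim])
  qed
  ultimately show "partial_order_on ?Q ?le"
    using sub by (simp add: partial_order_on_def preorder_on_def)
qed

end
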